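(* Let $K\in L^\infty_{\mathrm{loc}}([0,+\infty))$. (1) Suppose that $$K(t)\le\frac{1}{4(1+t)^2}\left[1+\frac{1}{\log^2(1+t)}\right]\qquad\text{on }(0,+\infty).$$ Then every solution $g$ of $$\begin{cases}g''+K(t)g\ge 0,\\ g(0)=0,\quad g'(0)=1\end{cases}$$ is positive on $(0,+\infty)$ and satisfies $g(t)\ge C\sqrt{t\log t}\,\log\log t$, for some $C>0$ and for all $t>3$. (2) Suppose that $$K(t)\le\frac{1}{4t^2}\left[1+\frac{1}{\log^2 t}\right]\qquad\text{on }[t_0,+\infty),$$ for some $t_0>0$. Then every solution $g\not\equiv 0$ of $g''+Kg=0$ is nonoscillatory.
   Context: Since $K$ is only locally bounded, solutions of $g''+Kg=0$ (respectively $g''+Kg\ge 0$) are $C^1$ functions on $[0,+\infty)$ with locally Lipschitz derivative satisfying the equation (respectively inequality) almost everywhere; pointwise inequalities on $K$ are understood almost everywhere. $\log^2 x$ means $(\log x)^2$. "Nonoscillatory" means having only finitely many zeros (if any) on $[0,+\infty)$. *)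

theory Defs
  imports "HOL-Analysis.Analysis"
begin

definition L_infty_loc :: "(real \<Rightarrow> real) \<Rightarrow> bool" where
  "L_infty_loc K \<longleftrightarrow>
     K \<in> borel_measurable (lebesgue_on {0..}) \<and>
     (\<forall>C. compact C \<and> C \<subseteq> {0..} \<longrightarrow> (\<exists>M. AE t in lebesgue_on C. \<bar>K t\<bar> \<le> M))"

definition locally_lipschitz_on :: "real set \<Rightarrow> (real \<Rightarrow> real) \<Rightarrow> bool" where
  "locally_lipschitz_on S f \<longleftrightarrow>
     (\<forall>x\<in>S. \<exists>u>0. \<exists>L. L-lipschitz_on (cball x u \<inter> S) f)"

(* Only the values of g and g' on [0,\<infinity>) matter; the derivative at 0 is the
   right one.  Continuity of g' follows from the local Lipschitz condition. *)
definition C1_lip_deriv :: "(real \<Rightarrow> real) \<Rightarrow> (real \<Rightarrow> real) \<Rightarrow> bool" where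
  "C1_lip_deriv g g' \<longleftrightarrow>
     (\<forall>t\<ge>0. (g has_real_derivative g' t) (at t within {0..})) \<and>
     locally_lipschitz_on {0..} g'"

(* A locally Lipschitz g' is differentiable almost everywhere, so asking for the
   existence of the second derivative d almost everywhere is no extra restriction. *)
definition ode_solution :: "(real \<Rightarrow> real) \<Rightarrow> (real \<Rightarrow> real) \<Rightarrow> (real \<Rightarrow> real) \<Rightarrow> bool" where
  "ode_solution K g g' \<longleftrightarrow>
     C1_lip_deriv g g' \<and>
     (AE t in lebesgue_on {0..}.
        \<exists>d. (g' has_real_derivative d) (at t within {0..}) \<and> d + K t * g t = 0)"

definition ode_supersolution :: "(real \<Rightarrow> real) \<Rightarrow> (real \<Rightarrow> real) \<Rightarrow> (real \<Rightarrow> real) \<Rightarrow> bool" where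
  "ode_supersolution K g g' \<longleftrightarrow>
     C1_lip_deriv g g' \<and>
     (AE t in lebesgue_on {0..}.
        \<exists>d. (g' has_real_derivative d) (at t within {0..}) \<and> d + K t * g t \<ge> 0)"

definition nonoscillatory :: "(real \<Rightarrow> real) \<Rightarrow> bool" where
  "nonoscillatory g \<longleftrightarrow> finite {t \<in> {0..}. g t = 0}"

end

theory Submission
  imports Defs
begin

text \<open>
  The function \<open>w s = sqrt (s * ln s)\<close> is a positive solution on \<open>(1, \<infinity>)\<close> of the
  equation \<open>w'' + q w = 0\<close> with the critical potential \<open>q s = (1 + 1 / (ln s)^2) / (4 s^2)\<close>;
  a second solution is \<open>w s * ln (ln s)\<close>. If \<open>K \<le> q\<close>, then as long as a supersolution \<open>g\<close>
  is nonnegative, its Wronskian \<open>W = g' w - g w'\<close> satisfies \<open>W' \<ge> (q - K) g w \<ge> 0\<close> almost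
  everywhere, hence is nondecreasing. Once \<open>g > 0\<close> and \<open>W \<ge> 0\<close>, the quotient \<open>g / w\<close> is
  therefore nondecreasing, so \<open>g\<close> stays positive forever.

  For (1), shift by \<open>s = 1 + t\<close>. Near \<open>t = 0\<close> one has \<open>W w / t \<longlongrightarrow> 1 - 1/2 > 0\<close>, which
  starts the argument, and integrating \<open>(g / w)' = W / w^2 \<ge> W c / (s ln s)\<close> from a point
  \<open>c < 1\<close> gives the lower bound. For (2), a zero of \<open>g\<close> is simple by
  uniqueness, so zeros do not accumulate; after a zero \<open>a > 1\<close> with \<open>K \<le> q\<close> beyond it, the
  argument applies to \<open>g\<close> or \<open>- g\<close>, so there is no later zero.
\<close>

section \<open>Monotonicity from the sign of the derivative almost everywhere\<close>

text \<open>By continuity the points where \<open>h\<close> is at least \<open>h a\<close> form a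
  closed set, which contains its supremum; were this below \<open>b\<close>, \<open>step\<close>
  would push it further right.\<close>

lemma locally_nondecreasing_to_the_right_imp_le:
  fixes h :: "real \<Rightarrow> real"
  assumes "a \<le> b" and cont: "continuous_on {a..b} h"
    and step: "\<And>x. a \<le> x \<Longrightarrow> x < b \<Longrightarrow> eventually (\<lambda>y. h x \<le> h y) (at_right x)"
  shows "h a \<le> h b"
proof -
  define S where "S = {x \<in> {a..b}. h a \<le> h x}"
  have "closed ({a..b} \<inter> h -` {h a..})"
    by (intro continuous_closed_preimage cont) auto
  moreover have "S = {a..b} \<inter> h -` {h a..}"
    by (auto simp: S_def)
  ultimately have "closed S" by simp
  have "a \<in> S" using \<open>a \<le> b\<close> by (simp add: S_def)
  have bdd: "bdd_above S" by (rule bdd_aboveI[of _ b]) (auto simp: S_def)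
  have s: "Sup S \<in> S"
    using \<open>a \<in> S\<close> bdd \<open>closed S\<close> by (intro closed_contains_Sup) auto
  show ?thesis
  proof (cases "Sup S = b")
    case True
    then show ?thesis using s by (simp add: S_def)
  next
    case False
    with s have "Sup S < b" "a \<le> Sup S" "h a \<le> h (Sup S)" by (auto simp: S_def)
    with step obtain c where c: "c > Sup S" "\<And>y. Sup S < y \<Longrightarrow> y < c \<Longrightarrow> h (Sup S) \<le> h y"
      by (auto simp: eventually_at_right_field)
    obtain y where y: "Sup S < y" "y < min b c"
      using dense[of "Sup S" "min b c"] \<open>Sup S < b\<close> c(1) by auto
    then have "y \<in> S"
      using c(2)[of y] \<open>a \<le> Sup S\<close> \<open>h a \<le> h (Sup S)\<close> by (auto simp: S_def)
    then have "y \<le> Sup S" using bdd by (rule cSup_upper)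
    with y show ?thesis by simp
  qed
qed

text \<open>
  Cover the exceptional null set by an open set \<open>U\<close> of small measure and add to \<open>f\<close> a small
  slope and a multiple of the measure of \<open>U \<inter> {a..x}\<close>: inside \<open>U\<close> the latter outweighs the
  Lipschitz constant, outside \<open>U\<close> the derivative of \<open>f\<close> is nonnegative.
\<close>
lemma lipschitz_AE_deriv_nonneg_imp_le:
  fixes f :: "real \<Rightarrow> real"
  assumes "a \<le> b" and lip: "L-lipschitz_on {a..b} f"
    and ae: "AE x in lebesgue. a < x \<and> x < b \<longrightarrow> (\<exists>d\<ge>0. (f has_real_derivative d) (at x))"
  shows "f a \<le> f b"
proof (rule ccontr)
  assume "\<not> f a \<le> f b"
  then have neg: "f a - f b > 0" by simp
  have "L \<ge> 0" using lip by (rule lipschitz_on_nonneg)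
  \<comment> \<open>The argument ends in \<open>f a - f b \<le> e * (b - a) + (L + 1) * r\<close>.
    The two constants make the right side at most a half plus a quarter of the positive drop
    \<open>f a - f b\<close>. The added \<open>1\<close> keeps each denominator positive.\<close>
  define e where "e = (f a - f b) / 2 / (b - a + 1)"
  define r where "r = (f a - f b) / 4 / (L + 1)"
  have "e > 0" "r > 0" using neg \<open>a \<le> b\<close> \<open>L \<ge> 0\<close> by (auto simp: e_def r_def)
  obtain N where N:
    "\<And>x. x \<in> space lebesgue - N \<Longrightarrow> a < x \<and> x < b \<longrightarrow> (\<exists>d\<ge>0. (f has_real_derivative d) (at x))"
    "N \<in> null_sets lebesgue"
    by (rule AE_E3[OF ae], rule that)
  \<comment> \<open>The derivative hypothesis is silent at \<open>a\<close>, where the local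
    condition must hold as well; covering \<open>a\<close> together with \<open>N\<close> treats it
    by the Lipschitz bound.\<close>
  have neglig: "insert a N \<in> null_sets lebesgue"
    using N(2) by (simp flip: negligible_iff_null_sets)
  obtain U where U: "open U" "insert a N \<subseteq> U" "emeasure lebesgue (U - insert a N) < ennreal r"
    using sets_lebesgue_outer_open[of "insert a N" r] neglig \<open>r > 0\<close> by (metis null_setsD2)
  have Us: "U \<in> sets lebesgue" using U(1) by (simp add: borel_open sets_completionI_sets)
  have eU: "emeasure lebesgue U < ennreal r"
    using U(3) neglig by (simp add: emeasure_Diff_null_set Us)
  have lt: "emeasure lebesgue (U \<inter> A) < ennreal r" for A
    using le_less_trans[OF emeasure_mono[OF Int_lower1 Us] eU] .
  have fin: "emeasure lebesgue (U \<inter> A) \<noteq> \<infinity>" for A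
    using less_trans[OF lt ennreal_less_top, of A] by simp
  have mU: "measure lebesgue (U \<inter> A) \<le> r" for A
    using lt[of A] \<open>r > 0\<close> by (simp add: measure_def enn2real_leI)
  define m where "m x = measure lebesgue (U \<inter> {a..x})" for x
  have split: "m y = m x + measure lebesgue (U \<inter> {x<..y})" if "a \<le> x" "x \<le> y" for x y
  proof -
    have "U \<inter> {a..y} = (U \<inter> {a..x}) \<union> (U \<inter> {x<..y})" using that by auto
    then show ?thesis unfolding m_def
      by (simp only:) (rule measure_Union; use fin Us in auto)
  qed
  have m_le: "\<bar>m y - m x\<bar> \<le> y - x" if "a \<le> x" "x \<le> y" for x y
  proof -
    have "measure lebesgue (U \<inter> {x<..y}) \<le> measure lebesgue (cbox x y)"
      by (rule measure_mono_fmeasurable) (use Us in auto)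
    then show ?thesis using split[OF that] that by simp
  qed
  have "1-lipschitz_on {a..b} m"
    using m_le by (intro lipschitz_on_leI) (auto simp: dist_real_def abs_minus_commute)
  define h where "h x = f x + e * (x - a) + (L + 1) * m x" for x
  have "h a \<le> h b"
  proof (rule locally_nondecreasing_to_the_right_imp_le[OF \<open>a \<le> b\<close>])
    show "continuous_on {a..b} h"
      unfolding h_def using lipschitz_on_continuous_on[OF lip]
        lipschitz_on_continuous_on[OF \<open>1-lipschitz_on {a..b} m\<close>]
      by (intro continuous_intros)
  next
    fix x assume x: "a \<le> x" "x < b"
    show "eventually (\<lambda>y. h x \<le> h y) (at_right x)"
    proof (cases "x \<in> U")
      case True
      then obtain c where c: "c > 0" "ball x c \<subseteq> U" using U(1) openE by blast
      have "h x \<le> h y" if y: "x < y" "y < min b (x + c)" for y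
      proof -
        have "U \<inter> {x<..y} = {x<..y}"
          using c(2) y by (auto simp: ball_def dist_real_def subset_eq)
        then have my: "m y = m x + (y - x)" using split[of x y] x y by simp
        have "(L + 1) * m y = (L + 1) * m x + L * (y - x) + (y - x)"
          unfolding my by (simp add: algebra_simps)
        moreover have "\<bar>f x - f y\<bar> \<le> L * (y - x)"
          using lipschitz_onD[OF lip, of x y] x y by (simp add: dist_real_def)
        moreover have "0 \<le> e * (y - x)" using y \<open>e > 0\<close> by simp
        ultimately show ?thesis using y unfolding h_def right_diff_distrib by linarith
      qed
      then show ?thesis using x c(1)
        by (auto simp: eventually_at_right_field intro!: exI[of _ "min b (x + c)"])
    next
      case False
      with U(2) have "x \<notin> N" "x \<noteq> a" by auto
      with N(1)[of x] x obtain d where d: "d \<ge> 0" "(f has_real_derivative d) (at x)" by auto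
      \<comment> \<open>The slope \<open>e\<close> makes the derivative strictly positive, and only
        then does its sign at one point force growth to the right.\<close>
      have "((\<lambda>x. f x + e * (x - a)) has_real_derivative d + e) (at x)"
        by (auto intro!: derivative_eq_intros d)
      from DERIV_pos_inc_right[OF this] d \<open>e > 0\<close> obtain c where c: "c > 0"
        "\<And>h. 0 < h \<Longrightarrow> h < c \<Longrightarrow> f x + e * (x - a) < f (x + h) + e * (x + h - a)" by auto
      have "h x \<le> h y" if y: "x < y" "y < x + c" for y
      proof -
        have "m x \<le> m y" using split[of x y] x y by simp
        then have "(L + 1) * m x \<le> (L + 1) * m y" using \<open>L \<ge> 0\<close> by (intro mult_left_mono) auto
        with c(2)[of "y - x"] y show ?thesis by (simp add: h_def)
      qed
      then show ?thesis using c(1) by (auto simp: eventually_at_right_field intro!: exI[of _ "x + c"])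
    qed
  qed
  moreover have "0 \<le> (L + 1) * m a" "(L + 1) * m b \<le> (L + 1) * r"
    using \<open>L \<ge> 0\<close> mU by (auto simp: m_def intro!: mult_nonneg_nonneg mult_left_mono)
  ultimately have "f a - f b \<le> e * (b - a) + (L + 1) * r"
    by (simp add: h_def)
  also have "e * (b - a) \<le> e * (b - a + 1)" using \<open>e > 0\<close> by simp
  also have "e * (b - a + 1) = (f a - f b) / 2"
    using \<open>a \<le> b\<close> unfolding e_def
    by (subst times_divide_eq_left, subst nonzero_mult_div_cancel_right) auto
  also have "(L + 1) * r = (f a - f b) / 4" using \<open>L \<ge> 0\<close> unfolding r_def
    by (subst times_divide_eq_right, subst nonzero_mult_div_cancel_left) auto
  finally show False using neg by simp
qed

section \<open>Lipschitz functions on compact intervals\<close>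

text \<open>Compactness bounds both factors. This makes Wronskians and weighted energies Lipschitz,
  so that the monotonicity criterion applies to them.\<close>

lemma lipschitz_on_mult_compact:
  fixes f g :: "'a::metric_space \<Rightarrow> real"
  assumes f: "C-lipschitz_on S f" and g: "D-lipschitz_on S g" and "compact S"
  obtains L where "L-lipschitz_on S (\<lambda>x. f x * g x)"
proof -
  have "bounded (f ` S)" "bounded (g ` S)"
    using assms by (auto intro!: compact_imp_bounded compact_continuous_image lipschitz_on_continuous_on)
  then obtain A B where A: "A > 0" "\<And>x. x \<in> S \<Longrightarrow> \<bar>f x\<bar> \<le> A" and B: "B > 0" "\<And>x. x \<in> S \<Longrightarrow> \<bar>g x\<bar> \<le> B"
    unfolding bounded_pos by (metis image_eqI real_norm_def)
  have "(A * D + B * C)-lipschitz_on S (\<lambda>x. f x * g x)"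
  proof (rule lipschitz_onI)
    fix x y assume xy: "x \<in> S" "y \<in> S"
    have "dist (f x * g x) (f y * g y) = \<bar>f x * (g x - g y) + g y * (f x - f y)\<bar>"
      by (simp add: dist_real_def algebra_simps)
    also have "\<dots> \<le> \<bar>f x\<bar> * \<bar>g x - g y\<bar> + \<bar>g y\<bar> * \<bar>f x - f y\<bar>"
      by (metis abs_mult abs_triangle_ineq)
    also have "\<dots> \<le> A * (D * dist x y) + B * (C * dist x y)"
      using A B lipschitz_onD[OF f xy] lipschitz_onD[OF g xy] xy
      by (intro add_mono mult_mono) (auto simp: dist_real_def)
    finally show "dist (f x * g x) (f y * g y) \<le> (A * D + B * C) * dist x y"
      by (simp add: algebra_simps)
  qed (use A B lipschitz_on_nonneg[OF f] lipschitz_on_nonneg[OF g] in auto)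
  then show ?thesis by (rule that)
qed

lemma C1_imp_lipschitz_on:
  fixes f f' :: "real \<Rightarrow> real"
  assumes der: "\<And>x. x \<in> {a..b} \<Longrightarrow> (f has_real_derivative f' x) (at x within {a..b})"
    and cont: "continuous_on {a..b} f'"
  obtains L where "L-lipschitz_on {a..b} f"
proof -
  obtain C where C: "C > 0" "\<And>x. x \<in> {a..b} \<Longrightarrow> \<bar>f' x\<bar> \<le> C"
    using compact_imp_bounded[OF compact_continuous_image[OF cont compact_Icc]]
    unfolding bounded_pos by (metis image_eqI real_norm_def)
  have "C-lipschitz_on {a..b} f"
  proof (rule bounded_derivative_imp_lipschitz)
    fix x assume x: "x \<in> {a..b}"
    show "(f has_derivative (*) (f' x)) (at x within {a..b})"
      using der[OF x] by (simp add: has_field_derivative_def)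
    show "onorm ((*) (f' x)) \<le> C"
      by (rule onorm_le) (use C(2)[OF x] in \<open>auto simp: abs_mult intro!: mult_right_mono\<close>)
  qed (use C in auto)
  then show ?thesis by (rule that)
qed

lemma locally_lipschitz_on_imp_lipschitz_on:
  assumes "locally_lipschitz_on S f" "compact X" "X \<subseteq> S"
  obtains L where "L-lipschitz_on X f"
proof -
  \<comment> \<open>\<open>local_lipschitz\<close> is about time-dependent families; a single dummy
    time makes its compactness theorem available.\<close>
  have "local_lipschitz {0::real} S (\<lambda>_. f)"
    using assms(1) unfolding locally_lipschitz_on_def local_lipschitz_def
    by (metis singletonD)
  then have "local_lipschitz {0::real} X (\<lambda>_. f)"
    by (rule local_lipschitz_subset) (use assms in auto)
  from local_lipschitz_compact_implies_lipschitz[OF this assms(2)] that show ?thesis by auto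
qed

section \<open>Regularity of functions with locally Lipschitz derivative\<close>

context
  fixes g g' :: "real \<Rightarrow> real"
  assumes g: "C1_lip_deriv g g'"
begin

lemma C1_lip_deriv_lipschitz_deriv:
  assumes "0 \<le> a"
  obtains L where "L-lipschitz_on {a..b} g'"
  by (rule locally_lipschitz_on_imp_lipschitz_on[of "{0..}" g' "{a..b}"])
    (use assms g that in \<open>auto simp: C1_lip_deriv_def\<close>)

lemma C1_lip_deriv_continuous_deriv:
  assumes "0 \<le> a"
  shows "continuous_on {a..b} g'"
  using C1_lip_deriv_lipschitz_deriv[OF assms] lipschitz_on_continuous_on by metis

lemma C1_lip_deriv_lipschitz:
  assumes "0 \<le> a"
  obtains L where "L-lipschitz_on {a..b} g"
proof (rule C1_imp_lipschitz_on)
  show "(g has_real_derivative g' x) (at x within {a..b})" if "x \<in> {a..b}" for x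
  proof (rule DERIV_subset)
    show "(g has_real_derivative g' x) (at x within {0..})" "{a..b} \<subseteq> {0..}"
      using g that assms by (auto simp: C1_lip_deriv_def)
  qed
qed (use that C1_lip_deriv_continuous_deriv[OF assms] in auto)

lemma C1_lip_deriv_has_deriv:
  assumes "0 < t"
  shows "(g has_real_derivative g' t) (at t)"
proof -
  have "(g has_real_derivative g' t) (at t within {0..})"
    using g assms by (simp add: C1_lip_deriv_def)
  moreover have "at t within {0..} = at t" using assms by (intro at_within_interior) auto
  ultimately show ?thesis by simp
qed

lemma C1_lip_deriv_isCont_deriv:
  assumes "0 < t"
  shows "isCont g' t"
  using C1_lip_deriv_continuous_deriv[of 0 "t + 1"] assms
  by (auto intro: continuous_on_interior)

end


section \<open>The differential inequality almost everywhere\<close>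

lemma AE_lebesgue_on_iff:
  assumes "S \<in> sets lebesgue"
  shows "(AE t in lebesgue_on S. P t) \<longleftrightarrow> (AE t in lebesgue. t \<in> S \<longrightarrow> P t)"
  using assms by (simp add: AE_restrict_space_iff)

lemma ode_supersolution_AE:
  assumes "ode_supersolution K g g'"
  shows "AE t in lebesgue. 0 < t \<longrightarrow> (\<exists>d. (g' has_real_derivative d) (at t) \<and> 0 \<le> d + K t * g t)"
proof -
  have "AE t in lebesgue. t \<in> {0..} \<longrightarrow>
      (\<exists>d. (g' has_real_derivative d) (at t within {0..}) \<and> 0 \<le> d + K t * g t)"
    using assms unfolding ode_supersolution_def by (subst (asm) AE_lebesgue_on_iff) auto
  then show ?thesis
  proof eventually_elim
    fix t :: real
    assume *: "t \<in> {0..} \<longrightarrow> (\<exists>d. (g' has_real_derivative d) (at t within {0..}) \<and> 0 \<le> d + K t * g t)"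
    have "at t within {0..} = at t" if "0 < t" using that by (intro at_within_interior) auto
    with * show "0 < t \<longrightarrow> (\<exists>d. (g' has_real_derivative d) (at t) \<and> 0 \<le> d + K t * g t)" by auto
  qed
qed

lemma ode_solution_imp_supersolution:
  assumes "ode_solution K g g'"
  shows "ode_supersolution K g g'"
  using assms unfolding ode_solution_def ode_supersolution_def
  by (auto elim!: eventually_mono)

lemma ode_solution_uminus:
  assumes "ode_solution K g g'"
  shows "ode_solution K (\<lambda>t. - g t) (\<lambda>t. - g' t)"
proof -
  have "C1_lip_deriv (\<lambda>t. - g t) (\<lambda>t. - g' t)"
    using assms by (auto simp: ode_solution_def C1_lip_deriv_def locally_lipschitz_on_def
        intro!: derivative_eq_intros)
  moreover have "AE t in lebesgue_on {0..}. \<exists>d. (g' has_real_derivative d) (at t within {0..}) \<and> d + K t * g t = 0"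
    using assms by (simp add: ode_solution_def)
  then have "AE t in lebesgue_on {0..}. \<exists>d. ((\<lambda>t. - g' t) has_real_derivative d) (at t within {0..})
      \<and> d + K t * - g t = 0"
  proof eventually_elim
    fix t
    assume "\<exists>d. (g' has_real_derivative d) (at t within {0..}) \<and> d + K t * g t = 0"
    then obtain d where "(g' has_real_derivative d) (at t within {0..})" "d + K t * g t = 0" by blast
    then show "\<exists>d. ((\<lambda>t. - g' t) has_real_derivative d) (at t within {0..}) \<and> d + K t * - g t = 0"
      by (intro exI[of _ "- d"]) (auto intro!: derivative_eq_intros)
  qed
  ultimately show ?thesis by (simp add: ode_solution_def)
qed

section \<open>Wronskian comparison\<close>

text \<open>Monotonicity of the Wronskian needs \<open>g\<close> nonnegative, and positivity of
  \<open>g\<close> needs a nonnegative Wronskian. The circle is broken at the first point where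
  \<open>g\<close> fails to be positive: the auxiliary facts ask for \<open>0 \<le> g x\<close> only
  strictly before \<open>b\<close>, so they apply up to that point.\<close>

lemma supersolution_comparison:
  fixes K g g' w w' q :: "real \<Rightarrow> real"
  assumes super: "ode_supersolution K g g'" and "0 < c"
    and w_pos: "\<And>t. c \<le> t \<Longrightarrow> 0 < w t"
    and w: "\<And>t. c \<le> t \<Longrightarrow> (w has_real_derivative w' t) (at t)"
    and w': "\<And>t. c \<le> t \<Longrightarrow> (w' has_real_derivative - q t * w t) (at t)"
    and q: "continuous_on {c..} q"
    and K: "AE t in lebesgue. c \<le> t \<longrightarrow> K t \<le> q t"
    and "0 < g c" and Wc: "0 \<le> g' c * w c - g c * w' c"
    and "c \<le> t"
  shows "0 < g t" "g' c * w c - g c * w' c \<le> g' t * w t - g t * w' t"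
proof -
  have C1: "C1_lip_deriv g g'" using super by (simp add: ode_supersolution_def)
  have g: "(g has_real_derivative g' t) (at t)" if "c \<le> t" for t
    using C1_lip_deriv_has_deriv[OF C1] that \<open>0 < c\<close> by simp
  define W where "W x = g' x * w x - g x * w' x" for x
  have W_mono: "W c \<le> W b" if "c \<le> b" and nonneg: "\<And>x. c < x \<Longrightarrow> x < b \<Longrightarrow> 0 \<le> g x" for b
  proof -
    have w_cont: "continuous_on {c..b} w" and w'_cont: "continuous_on {c..b} w'"
      using w w' by (auto intro!: DERIV_isCont continuous_at_imp_continuous_on)
    have q_cont: "continuous_on {c..b} q" using q by (rule continuous_on_subset) auto
    obtain L1 where L1: "L1-lipschitz_on {c..b} g'"
      using C1_lip_deriv_lipschitz_deriv[OF C1] \<open>0 < c\<close> by (meson less_imp_le)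
    obtain L2 where L2: "L2-lipschitz_on {c..b} g"
      using C1_lip_deriv_lipschitz[OF C1] \<open>0 < c\<close> by (meson less_imp_le)
    obtain L3 where L3: "L3-lipschitz_on {c..b} w"
      by (rule C1_imp_lipschitz_on[OF _ w'_cont]) (use w in \<open>auto intro: has_field_derivative_at_within\<close>)
    obtain L4 where L4: "L4-lipschitz_on {c..b} w'"
      by (rule C1_imp_lipschitz_on[of c b w' "\<lambda>t. - q t * w t"])
        (use w' in \<open>auto intro: has_field_derivative_at_within intro!: continuous_intros q_cont w_cont\<close>)
    obtain L5 where L5: "L5-lipschitz_on {c..b} (\<lambda>x. g' x * w x)"
      using lipschitz_on_mult_compact[OF L1 L3 compact_Icc] .
    obtain L6 where L6: "L6-lipschitz_on {c..b} (\<lambda>x. g x * w' x)"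
      using lipschitz_on_mult_compact[OF L2 L4 compact_Icc] .
    have "(L5 + L6)-lipschitz_on {c..b} W"
      unfolding W_def by (rule lipschitz_on_diff[OF L5 L6])
    moreover have "AE x in lebesgue. c < x \<and> x < b \<longrightarrow> (\<exists>d\<ge>0. (W has_real_derivative d) (at x))"
      using ode_supersolution_AE[OF super] K
    proof eventually_elim
      case (elim x)
      show ?case
      proof
        assume x: "c < x \<and> x < b"
        with elim \<open>0 < c\<close> obtain d where d: "(g' has_real_derivative d) (at x)" "0 \<le> d + K x * g x"
          by auto
        \<comment> \<open>The terms \<open>g' x * w' x\<close> cancel, and \<open>d\<close> stands
          for the second derivative of \<open>g\<close>.\<close>
        have "(W has_real_derivative (d + q x * g x) * w x) (at x)"
          unfolding W_def using x
          by (auto intro!: derivative_eq_intros d g w w' simp: algebra_simps)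
        moreover have "K x * g x \<le> q x * g x"
          using elim x nonneg by (intro mult_right_mono) auto
        then have "0 \<le> (d + q x * g x) * w x"
          using d x w_pos[of x] by simp
        ultimately show "\<exists>d\<ge>0. (W has_real_derivative d) (at x)" by blast
      qed
    qed
    ultimately show ?thesis
      by (rule lipschitz_AE_deriv_nonneg_imp_le[OF that(1)])
  qed
  have quotient_mono: "g c / w c \<le> g b / w b"
    if "c \<le> b" and nonneg: "\<And>x. c < x \<Longrightarrow> x < b \<Longrightarrow> 0 \<le> g x" for b
  proof (rule DERIV_nonneg_imp_nondecreasing[OF that(1)])
    fix x assume x: "c \<le> x" "x \<le> b"
    have "((\<lambda>x. g x / w x) has_real_derivative W x / (w x)\<^sup>2) (at x)"
      using x w_pos[of x]
      by (auto intro!: derivative_eq_intros g w simp: W_def power2_eq_square)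
    moreover have "0 \<le> W x" using W_mono[of x] x nonneg Wc by (force simp: W_def)
    ultimately show "\<exists>y. ((\<lambda>x. g x / w x) has_real_derivative y) (at x) \<and> 0 \<le> y"
      by (intro exI[of _ "W x / (w x)\<^sup>2"]) auto
  qed
  have pos: "0 < g b" if "c \<le> b" for b
  proof (rule ccontr)
    assume "\<not> 0 < g b"
    \<comment> \<open>\<open>Inf S\<close> is the first point with \<open>g \<le> 0\<close>. There
      \<open>g / w\<close> would be nonpositive, although it cannot have dropped below its positive
      value at \<open>c\<close>.\<close>
    define S where "S = {c..b} \<inter> g -` {..0}"
    have "continuous_on {c..b} g"
      using g by (auto intro!: DERIV_isCont continuous_at_imp_continuous_on)
    then have "closed S" unfolding S_def by (intro continuous_closed_preimage) auto
    moreover have "b \<in> S" using that \<open>\<not> 0 < g b\<close> by (simp add: S_def)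
    moreover have bdd: "bdd_below S" by (rule bdd_belowI[of _ c]) (auto simp: S_def)
    ultimately have s: "Inf S \<in> S" by (intro closed_contains_Inf) auto
    have "0 \<le> g x" if "c < x" "x < Inf S" for x
    proof (rule ccontr)
      assume "\<not> 0 \<le> g x"
      with that s have "x \<in> S" by (auto simp: S_def)
      then show False using cInf_lower[OF _ bdd] that by fastforce
    qed
    then have "g c / w c \<le> g (Inf S) / w (Inf S)"
      using quotient_mono[of "Inf S"] s by (auto simp: S_def)
    moreover have "0 < g c / w c" using \<open>0 < g c\<close> w_pos by simp
    moreover have "g (Inf S) / w (Inf S) \<le> 0"
      using s w_pos[of "Inf S"] by (intro divide_nonpos_pos) (auto simp: S_def)
    ultimately show False by simp
  qed
  show "0 < g t" using pos \<open>c \<le> t\<close> by simp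
  show "g' c * w c - g c * w' c \<le> g' t * w t - g t * w' t"
    using W_mono[OF \<open>c \<le> t\<close>] pos by (simp add: W_def less_imp_le)
qed


section \<open>Uniqueness and finiteness of zeros on compact intervals\<close>

text \<open>The energy \<open>E\<close> is nonnegative and vanishes at \<open>s\<close>. Forward in
  time \<open>E t * exp (- (1 + M) * t)\<close> is nonincreasing, and backward in time one uses that
  \<open>E t * exp ((1 + M) * t)\<close> is nondecreasing; either way
  \<open>E r \<le> 0\<close>.\<close>

lemma ode_solution_zero_data_imp_zero:
  assumes K: "L_infty_loc K" and sol: "ode_solution K g g'"
    and s: "0 \<le> s" "g s = 0" "g' s = 0" and "0 \<le> r"
  shows "g r = 0"
proof -
  define R where "R = max s r"
  have C1: "C1_lip_deriv g g'" using sol by (simp add: ode_solution_def)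
  obtain M where M: "AE t in lebesgue_on {0..R}. \<bar>K t\<bar> \<le> M"
    using K unfolding L_infty_loc_def by (metis Icc_subset_Ici_iff compact_Icc order_refl)
  \<comment> \<open>Gronwall: \<open>\<bar>E'\<bar> \<le> (1 + M) E\<close> almost everywhere.\<close>
  define E where "E t = g t * g t + g' t * g' t" for t
  obtain L1 where L1: "L1-lipschitz_on {0..R} g"
    using C1_lip_deriv_lipschitz[OF C1] by blast
  obtain L2 where L2: "L2-lipschitz_on {0..R} g'"
    using C1_lip_deriv_lipschitz_deriv[OF C1] by blast
  obtain L3 where L3: "L3-lipschitz_on {0..R} (\<lambda>t. g t * g t)"
    using lipschitz_on_mult_compact[OF L1 L1 compact_Icc] .
  obtain L4 where L4: "L4-lipschitz_on {0..R} (\<lambda>t. g' t * g' t)"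
    using lipschitz_on_mult_compact[OF L2 L2 compact_Icc] .
  have E_lip: "(L3 + L4)-lipschitz_on {0..R} E"
    unfolding E_def by (rule lipschitz_on_add[OF L3 L4])
  have E_exp_lip: "\<exists>L. L-lipschitz_on {0..R} (\<lambda>t. E t * exp (k * t))" for k
  proof -
    obtain L where "L-lipschitz_on {0..R} (\<lambda>t. exp (k * t))"
      by (rule C1_imp_lipschitz_on[of 0 R "\<lambda>t. exp (k * t)" "\<lambda>t. k * exp (k * t)"])
        (auto intro!: derivative_eq_intros continuous_intros)
    from lipschitz_on_mult_compact[OF E_lip this compact_Icc] show ?thesis by metis
  qed
  have E_deriv: "AE t in lebesgue. 0 < t \<and> t < R \<longrightarrow>
      (\<exists>d. (E has_real_derivative d) (at t) \<and> \<bar>d\<bar> \<le> (1 + M) * E t)"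
  proof -
    have M': "AE t in lebesgue. t \<in> {0..R} \<longrightarrow> \<bar>K t\<bar> \<le> M"
      using M by (subst (asm) AE_lebesgue_on_iff) auto
    have "AE t in lebesgue. t \<in> {0..} \<longrightarrow>
        (\<exists>d. (g' has_real_derivative d) (at t within {0..}) \<and> d + K t * g t = 0)"
      using conjunct2[OF sol[unfolded ode_solution_def]]
      by (subst (asm) AE_lebesgue_on_iff) auto
    then show ?thesis using M'
    proof eventually_elim
      case (elim t)
      show ?case
      proof
        assume t: "0 < t \<and> t < R"
        then have "at t within {0..} = at t" by (intro at_within_interior) auto
        with elim t obtain d where d: "(g' has_real_derivative d) (at t)" "d = - (K t * g t)"
          by (auto simp: add_eq_0_iff)
        \<comment> \<open>Substituting the equation turns the second derivative of \<open>g\<close>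
          into \<open>- K t * g t\<close>, so both terms share the factor
          \<open>2 * g t * g' t\<close>, which is at most \<open>E t\<close> in absolute
          value.\<close>
        have "(E has_real_derivative 2 * g t * g' t * (1 - K t)) (at t)"
          unfolding E_def using t
          by (auto intro!: derivative_eq_intros d(1) C1_lip_deriv_has_deriv[OF C1]
              simp: d(2) algebra_simps)
        moreover have "\<bar>2 * g t * g' t * (1 - K t)\<bar> \<le> (1 + M) * E t"
        proof -
          have "\<bar>2 * g t * g' t\<bar> \<le> E t"
            using sum_squares_bound[of "g t" "g' t"] sum_squares_bound[of "g t" "- g' t"]
            by (auto simp: E_def power2_eq_square abs_le_iff)
          moreover have "\<bar>1 - K t\<bar> \<le> 1 + M" using elim t by auto
          ultimately have "\<bar>2 * g t * g' t\<bar> * \<bar>1 - K t\<bar> \<le> E t * (1 + M)"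
            by (intro mult_mono) (auto simp: E_def)
          then show ?thesis by (simp only: abs_mult mult.commute)
        qed
        ultimately show "\<exists>d. (E has_real_derivative d) (at t) \<and> \<bar>d\<bar> \<le> (1 + M) * E t" by blast
      qed
    qed
  qed
  have "E s = 0" using s by (simp add: E_def)
  have "E r \<le> 0"
  proof (cases "s \<le> r")
    case True
    obtain L where "L-lipschitz_on {0..R} (\<lambda>t. E t * exp (- (1 + M) * t))"
      using E_exp_lip by blast
    then have "L-lipschitz_on {s..r} (\<lambda>t. E t * exp (- (1 + M) * t))"
      by (rule lipschitz_on_subset) (use s in \<open>auto simp: R_def\<close>)
    \<comment> \<open>The criterion is phrased for nondecreasing functions, hence the sign.\<close>
    then have "L-lipschitz_on {s..r} (\<lambda>t. - (E t * exp (- (1 + M) * t)))"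
      by (rule lipschitz_on_minus)
    then have "- (E s * exp (- (1 + M) * s)) \<le> - (E r * exp (- (1 + M) * r))"
    proof (rule lipschitz_AE_deriv_nonneg_imp_le[OF True])
      show "AE t in lebesgue. s < t \<and> t < r \<longrightarrow>
        (\<exists>d\<ge>0. ((\<lambda>t. - (E t * exp (- (1 + M) * t))) has_real_derivative d) (at t))"
        using E_deriv
      proof eventually_elim
        case (elim t)
        show ?case
        proof
          assume "s < t \<and> t < r"
          with elim s obtain d where d: "(E has_real_derivative d) (at t)" "\<bar>d\<bar> \<le> (1 + M) * E t"
            by (auto simp: R_def)
          have "((\<lambda>t. - (E t * exp (- (1 + M) * t))) has_real_derivative
              ((1 + M) * E t - d) * exp (- (1 + M) * t)) (at t)"
            by (auto intro!: derivative_eq_intros d(1) simp: algebra_simps)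
          then show "\<exists>d\<ge>0. ((\<lambda>t. - (E t * exp (- (1 + M) * t))) has_real_derivative d) (at t)"
            using d(2) by (intro exI conjI) auto
        qed
      qed
    qed
    then show ?thesis using \<open>E s = 0\<close> by (simp add: mult_le_0_iff)
  next
    case False
    then have "r \<le> s" by simp
    obtain L where "L-lipschitz_on {0..R} (\<lambda>t. E t * exp ((1 + M) * t))"
      using E_exp_lip by blast
    then have "L-lipschitz_on {r..s} (\<lambda>t. E t * exp ((1 + M) * t))"
      by (rule lipschitz_on_subset) (use \<open>0 \<le> r\<close> in \<open>auto simp: R_def\<close>)
    then have "E r * exp ((1 + M) * r) \<le> E s * exp ((1 + M) * s)"
    proof (rule lipschitz_AE_deriv_nonneg_imp_le[OF \<open>r \<le> s\<close>])
      show "AE t in lebesgue. r < t \<and> t < s \<longrightarrow>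
        (\<exists>d\<ge>0. ((\<lambda>t. E t * exp ((1 + M) * t)) has_real_derivative d) (at t))"
        using E_deriv
      proof eventually_elim
        case (elim t)
        show ?case
        proof
          assume "r < t \<and> t < s"
          with elim \<open>0 \<le> r\<close> obtain d
            where d: "(E has_real_derivative d) (at t)" "\<bar>d\<bar> \<le> (1 + M) * E t"
            by (auto simp: R_def)
          have "((\<lambda>t. E t * exp ((1 + M) * t)) has_real_derivative
              ((1 + M) * E t + d) * exp ((1 + M) * t)) (at t)"
            by (auto intro!: derivative_eq_intros d(1) simp: algebra_simps)
          then show "\<exists>d\<ge>0. ((\<lambda>t. E t * exp ((1 + M) * t)) has_real_derivative d) (at t)"
            using d(2) by (intro exI conjI) auto
        qed
      qed
    qed
    then show ?thesis using \<open>E s = 0\<close> by (simp add: mult_le_0_iff)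
  qed
  then show ?thesis
    unfolding E_def by (metis sum_squares_le_zero_iff)
qed

text \<open>Infinitely many zeros would accumulate at some \<open>x\<close>. Difference quotients
  taken along zeros are \<open>0\<close>, so \<open>g\<close> and \<open>g'\<close> both vanish at
  \<open>x\<close>, and uniqueness makes \<open>g\<close> vanish identically.\<close>

lemma ode_solution_finite_zeros_Icc:
  assumes K: "L_infty_loc K" and sol: "ode_solution K g g'" and nz: "\<exists>t\<ge>0. g t \<noteq> 0"
  shows "finite {t \<in> {0..R}. g t = 0}" (is "finite ?Z")
proof (rule ccontr)
  assume "infinite ?Z"
  then obtain x where x: "x \<in> {0..R}" "x islimpt ?Z"
    using Heine_Borel_imp_Bolzano_Weierstrass[OF compact_Icc, of ?Z 0 R] by blast
  have C1: "C1_lip_deriv g g'" using sol by (simp add: ode_solution_def)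
  obtain L where "L-lipschitz_on {0..R} g" using C1_lip_deriv_lipschitz[OF C1] by blast
  then have "closed ({0..R} \<inter> g -` {0})"
    by (intro continuous_closed_preimage lipschitz_on_continuous_on) auto
  moreover have "{0..R} \<inter> g -` {0} = ?Z" by auto
  ultimately have "g x = 0" using x(2) closed_limpt by auto
  \<comment> \<open>The derivative is restricted to the zero set; since \<open>x\<close> is a limit
    point of it, limits there are still unique.\<close>
  have "(g has_real_derivative g' x) (at x within ?Z)"
    using C1 x(1) by (auto simp: C1_lip_deriv_def intro: DERIV_subset)
  then have "((\<lambda>y. (g y - g x) / (y - x)) \<longlongrightarrow> g' x) (at x within ?Z)"
    by (simp add: has_field_derivative_iff)
  moreover have "((\<lambda>y. (g y - g x) / (y - x)) \<longlongrightarrow> 0) (at x within ?Z)"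
    using \<open>g x = 0\<close> by (intro tendsto_eventually) (auto simp: eventually_at_filter)
  ultimately have "g' x = 0"
    using x(2) by (meson tendsto_unique trivial_limit_within)
  with \<open>g x = 0\<close> x(1) nz show False
    using ode_solution_zero_data_imp_zero[OF K sol] by auto
qed

section \<open>The critical equation and its solution\<close>

definition critical_potential :: "real \<Rightarrow> real" where
  "critical_potential s = 1 / (4 * s\<^sup>2) * (1 + 1 / (ln s)\<^sup>2)"

definition critical_solution :: "real \<Rightarrow> real" where
  "critical_solution s = sqrt (s * ln s)"

text \<open>In this form the product with \<open>critical_solution s\<close> is
  \<open>(ln s + 1) / 2\<close>, free of square roots.\<close>

definition critical_solution_deriv :: "real \<Rightarrow> real" where
  "critical_solution_deriv s = (ln s + 1) / (2 * critical_solution s)"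

context
  fixes s :: real
  assumes s: "1 < s"
begin

lemma critical_solution_pos: "0 < critical_solution s"
  using s by (simp add: critical_solution_def)

lemma critical_solution_square: "(critical_solution s)\<^sup>2 = s * ln s"
  unfolding critical_solution_def using s by (intro real_sqrt_pow2 mult_nonneg_nonneg) auto

lemma critical_solution_has_deriv:
  "(critical_solution has_real_derivative critical_solution_deriv s) (at s)"
proof -
  have "((\<lambda>s. s * ln s) has_real_derivative ln s + 1) (at s)"
    using s by (auto intro!: derivative_eq_intros)
  moreover have "0 < s * ln s" using s by simp
  ultimately have "((\<lambda>s. sqrt (s * ln s)) has_real_derivative inverse (sqrt (s * ln s)) / 2 * (ln s + 1)) (at s)"
    by (intro DERIV_chain2[OF DERIV_real_sqrt])
  then show ?thesis
    unfolding critical_solution_def critical_solution_deriv_def by (simp add: field_simps)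
qed

text \<open>With \<open>r\<close> the critical solution and \<open>l = ln s\<close>, the relation
  \<open>r * r = s * l\<close> gives \<open>r / s = l / r\<close>. The numerator of the quotient
  rule becomes \<open>- (l\<^sup>2 + 1) / r\<close>, and \<open>l\<^sup>2 + 1\<close> is the
  critical potential times \<open>4 * r ^ 4\<close>.\<close>

lemma critical_solution_deriv_has_deriv:
  "(critical_solution_deriv has_real_derivative - critical_potential s * critical_solution s) (at s)"
proof -
  let ?r = "critical_solution s" and ?l = "ln s"
  have r: "?r > 0" "?r * ?r = s * ?l" and l: "?l > 0"
    using critical_solution_pos critical_solution_square s by (auto simp: power2_eq_square)
  have "((\<lambda>s. (ln s + 1) / (2 * critical_solution s)) has_real_derivative
      (1 / s * (2 * ?r) - (?l + 1) * (2 * critical_solution_deriv s)) / ((2 * ?r) * (2 * ?r))) (at s)"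
    using s r by (auto intro!: derivative_eq_intros critical_solution_has_deriv)
  also have "(1 / s * (2 * ?r) - (?l + 1) * (2 * critical_solution_deriv s)) / ((2 * ?r) * (2 * ?r))
      = - critical_potential s * ?r"
  proof -
    have "?r / s = ?l / ?r" using s r by (simp add: frac_eq_eq mult.commute)
    then have eq: "1 / s * (2 * ?r) = 2 * ?l / ?r" by simp
    have "1 / s * (2 * ?r) - (?l + 1) * (2 * critical_solution_deriv s) = - (?l\<^sup>2 + 1) / ?r"
      unfolding eq using r(1) by (simp add: critical_solution_deriv_def field_simps power2_eq_square)
    also have "\<dots> = - critical_potential s * ?r * (4 * (?r * ?r))"
    proof -
      have "critical_potential s * (4 * (?r * ?r) * (?r * ?r)) = ?l\<^sup>2 + 1"
        unfolding r critical_potential_def using s l by (simp add: field_simps power2_eq_square)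
      then show ?thesis using r(1) by (simp add: field_simps)
    qed
    finally show ?thesis using r(1) by simp
  qed
  finally show ?thesis unfolding critical_solution_deriv_def .
qed

lemma critical_potential_isCont: "isCont critical_potential s"
  unfolding critical_potential_def using s by (intro continuous_intros) auto

end

text \<open>The shift \<open>a\<close> serves both parts of the theorem: it is \<open>1\<close> for
  the first and \<open>0\<close> for the second. The condition \<open>1 < a + c\<close> keeps
  \<open>a + t\<close> where the logarithm is positive.\<close>

lemma critical_comparison:
  assumes "ode_supersolution K g g'" and c: "0 < c" "1 < a + c"
    and K: "AE t in lebesgue. c \<le> t \<longrightarrow> K t \<le> critical_potential (a + t)"
    and "0 < g c"
    and "0 \<le> g' c * critical_solution (a + c) - g c * critical_solution_deriv (a + c)"
    and "c \<le> t"
  shows "0 < g t"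
    and "g' c * critical_solution (a + c) - g c * critical_solution_deriv (a + c)
      \<le> g' t * critical_solution (a + t) - g t * critical_solution_deriv (a + t)"
proof -
  have 1: "1 < a + t" if "c \<le> t" for t using that c by simp
  have "((\<lambda>t. critical_solution (a + t)) has_real_derivative critical_solution_deriv (a + t)) (at t)"
    "((\<lambda>t. critical_solution_deriv (a + t)) has_real_derivative
      - critical_potential (a + t) * critical_solution (a + t)) (at t)" if "c \<le> t" for t
    using critical_solution_has_deriv[OF 1[OF that]] critical_solution_deriv_has_deriv[OF 1[OF that]]
      DERIV_shift[of critical_solution "critical_solution_deriv (a + t)" t a]
      DERIV_shift[of critical_solution_deriv "- critical_potential (a + t) * critical_solution (a + t)" t a]
    by (simp_all add: add.commute)
  moreover have "continuous_on {c..} (\<lambda>t. critical_potential (a + t))"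
    using 1 by (auto intro!: continuous_at_imp_continuous_on isCont_o2[OF _ critical_potential_isCont]
        continuous_intros)
  ultimately show "0 < g t"
    and "g' c * critical_solution (a + c) - g c * critical_solution_deriv (a + c)
      \<le> g' t * critical_solution (a + t) - g t * critical_solution_deriv (a + t)"
    using supersolution_comparison[where w = "\<lambda>t. critical_solution (a + t)"
        and w' = "\<lambda>t. critical_solution_deriv (a + t)" and q = "\<lambda>t. critical_potential (a + t)"]
      assms critical_solution_pos[OF 1] by blast+
qed


section \<open>Starting points for the comparison\<close>

text \<open>The comparison cannot start at \<open>a\<close>, because \<open>g a = 0\<close>. The
  Wronskian at \<open>a\<close> is \<open>g' a * critical_solution a > 0\<close>, so by continuity
  some \<open>c\<close> between \<open>a\<close> and \<open>b\<close> has both \<open>g c\<close>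
  and the Wronskian positive.\<close>

lemma supersolution_pos_after_zero:
  assumes super: "ode_supersolution K g g'"
    and K: "AE t in lebesgue. T \<le> t \<longrightarrow> K t \<le> critical_potential t"
    and a: "1 < T" "T \<le> a" "g a = 0" "0 < g' a" and "a < b"
  shows "0 < g b"
proof -
  have C1: "C1_lip_deriv g g'" using super by (simp add: ode_supersolution_def)
  have g: "(g has_real_derivative g' a) (at a)"
    using a by (intro C1_lip_deriv_has_deriv[OF C1]) auto
  define W where "W t = g' t * critical_solution t - g t * critical_solution_deriv t" for t
  have "isCont W a"
    unfolding W_def using a
    by (intro continuous_intros C1_lip_deriv_isCont_deriv[OF C1] DERIV_isCont[OF g]
        DERIV_isCont[OF critical_solution_has_deriv] DERIV_isCont[OF critical_solution_deriv_has_deriv]) auto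
  moreover have "0 < W a" using a critical_solution_pos[of a] by (simp add: W_def)
  ultimately have "eventually (\<lambda>t. 0 < W t) (at a)"
    by (metis isContD order_tendstoD(1))
  then have "eventually (\<lambda>t. 0 < W t) (at_right a)"
    by (rule filter_leD[OF at_le, rotated]) simp
  moreover obtain d where "0 < d" "\<And>h. 0 < h \<Longrightarrow> h < d \<Longrightarrow> g a < g (a + h)"
    using DERIV_pos_inc_right[OF g \<open>0 < g' a\<close>] by auto
  then have "eventually (\<lambda>t. 0 < g t) (at_right a)"
    using \<open>g a = 0\<close> unfolding eventually_at_right_field
    by (intro exI[of _ "a + d"]) (metis add_diff_cancel_left' add.commute diff_add_cancel diff_gt_0_iff_gt
        less_add_same_cancel1 less_diff_eq)
  moreover have "eventually (\<lambda>t. a < t \<and> t < b) (at_right a)"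
    using \<open>a < b\<close> unfolding eventually_at_right_field by blast
  ultimately have "eventually (\<lambda>t. 0 < W t \<and> 0 < g t \<and> a < t \<and> t < b) (at_right a)"
    by eventually_elim simp
  then obtain c where c: "0 < W c" "0 < g c" "a < c" "c < b"
    using eventually_happens' trivial_limit_at_right_real by blast
  have "AE t in lebesgue. c \<le> t \<longrightarrow> K t \<le> critical_potential (0 + t)"
    using K by eventually_elim (use a c in auto)
  then show ?thesis
    by (rule critical_comparison(1)[OF super, of c 0, rotated 2]) (use a c in \<open>auto simp: W_def\<close>)
qed

text \<open>The critical solution vanishes at \<open>1\<close> and its derivative blows up there, so
  the sign of the Wronskian is found by a limit instead of evaluation at \<open>0\<close>. The bound
  \<open>d\<close> lets the starting point lie below any prescribed time.\<close>

lemma supersolution_initially_pos: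
  assumes super: "ode_supersolution K g g'" and "g 0 = 0" "g' 0 = 1" and "0 < d"
  obtains c where "0 < c" "c < d" "0 < g c"
    "0 < g' c * critical_solution (1 + c) - g c * critical_solution_deriv (1 + c)"
proof -
  have C1: "C1_lip_deriv g g'" using super by (simp add: ode_supersolution_def)
  have "continuous (at 0 within {0..1}) g'"
    using C1_lip_deriv_continuous_deriv[OF C1, of 0 1] by (simp add: continuous_on_eq_continuous_within)
  then have g': "(g' \<longlongrightarrow> 1) (at_right 0)"
    using \<open>g' 0 = 1\<close> by (simp add: continuous_within at_within_Icc_at_right)
  have "(g has_real_derivative 1) (at 0 within {0..})"
    using C1 \<open>g' 0 = 1\<close> unfolding C1_lip_deriv_def by (metis order_refl)
  then have "(g has_real_derivative 1) (at_right 0)"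
    by (rule DERIV_subset) auto
  then have g: "((\<lambda>t. g t / t) \<longlongrightarrow> 1) (at_right 0)"
    using \<open>g 0 = 0\<close> by (simp add: has_field_derivative_iff)
  have "((\<lambda>t. ln (1 + t)) has_real_derivative 1) (at_right 0)"
    by (auto intro!: derivative_eq_intros)
  then have ln: "((\<lambda>t. ln (1 + t) / t) \<longlongrightarrow> 1) (at_right (0::real))"
    by (simp add: has_field_derivative_iff)
  have ln0: "((\<lambda>t. ln (1 + t)) \<longlongrightarrow> ln (1 + 0)) (at_right (0::real))"
    by (intro tendsto_intros) auto
  \<comment> \<open>This expression is the Wronskian multiplied by
    \<open>critical_solution (1 + t) / t\<close>, a positive factor for \<open>t > 0\<close>; its
    limit is \<open>1 / 2\<close>.\<close>
  have "((\<lambda>t. g' t * (1 + t) * (ln (1 + t) / t) - g t / t * ((ln (1 + t) + 1) / 2))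
      \<longlongrightarrow> 1 * (1 + 0) * 1 - 1 * ((ln (1 + 0) + 1) / 2)) (at_right 0)"
    by (intro tendsto_intros g' g ln ln0) auto
  then have "eventually (\<lambda>t. 0 < g' t * (1 + t) * (ln (1 + t) / t) - g t / t * ((ln (1 + t) + 1) / 2))
      (at_right 0)"
    by (rule order_tendstoD(1)) simp
  moreover have "eventually (\<lambda>t. 0 < g t / t) (at_right 0)"
    using g by (rule order_tendstoD(1)) simp
  moreover have "eventually (\<lambda>t. 0 < t \<and> t < d) (at_right 0)"
    using \<open>0 < d\<close> unfolding eventually_at_right_field by blast
  ultimately have "eventually (\<lambda>t. 0 < g' t * (1 + t) * (ln (1 + t) / t) - g t / t * ((ln (1 + t) + 1) / 2)
      \<and> 0 < g t / t \<and> 0 < t \<and> t < d) (at_right 0)"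
    by eventually_elim simp
  then obtain c where c: "0 < g' c * (1 + c) * (ln (1 + c) / c) - g c / c * ((ln (1 + c) + 1) / 2)"
    "0 < g c / c" "0 < c" "c < d"
    using eventually_happens' trivial_limit_at_right_real by blast
  let ?r = "critical_solution (1 + c)"
  have r: "0 < ?r" "?r * ?r = (1 + c) * ln (1 + c)"
    using critical_solution_pos[of "1 + c"] critical_solution_square[of "1 + c"] c(3)
    by (auto simp: power2_eq_square)
  have "g' c * ?r - g c * critical_solution_deriv (1 + c)
      = (g' c * (?r * ?r) - g c * ((ln (1 + c) + 1) / 2)) / ?r"
    using r(1) by (simp add: critical_solution_deriv_def field_simps)
  also have "\<dots> = (g' c * (1 + c) * (ln (1 + c) / c) - g c / c * ((ln (1 + c) + 1) / 2)) * c / ?r"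
    unfolding r(2) using c(3) by (simp add: left_diff_distrib mult.assoc)
  finally have "0 < g' c * ?r - g c * critical_solution_deriv (1 + c)"
    using c(1,3) r(1) by simp
  then show ?thesis using that c by (simp add: zero_less_divide_iff)
qed

section \<open>Growth and nonoscillation under the critical bound\<close>

theorem theorem10:
  fixes K :: "real \<Rightarrow> real"
  assumes "L_infty_loc K"
  shows
    "((AE t in lebesgue_on {0<..}. K t \<le> 1 / (4 * (1 + t)\<^sup>2) * (1 + 1 / (ln (1 + t))\<^sup>2)) \<longrightarrow>
        (\<forall>g g'. ode_supersolution K g g' \<and> g 0 = 0 \<and> g' 0 = 1 \<longrightarrow>
           (\<forall>t>0. g t > 0) \<and>
           (\<exists>C>0. \<forall>t>3. g t \<ge> C * (sqrt (t * ln t) * ln (ln t)))))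
     \<and>
     (\<forall>t\<^sub>0>0. (AE t in lebesgue_on {t\<^sub>0..}. K t \<le> 1 / (4 * t\<^sup>2) * (1 + 1 / (ln t)\<^sup>2)) \<longrightarrow>
        (\<forall>g g'. ode_solution K g g' \<and> (\<exists>t\<ge>0. g t \<noteq> 0) \<longrightarrow> nonoscillatory g))"
proof (intro conjI[of "_ \<longrightarrow> _"] impI allI)
  fix g g'
  assume "AE t in lebesgue_on {0<..}. K t \<le> 1 / (4 * (1 + t)\<^sup>2) * (1 + 1 / (ln (1 + t))\<^sup>2)"
  then have K: "AE t in lebesgue. t \<in> {0<..} \<longrightarrow> K t \<le> critical_potential (1 + t)"
    unfolding critical_potential_def by (subst (asm) AE_lebesgue_on_iff) auto
  assume "ode_supersolution K g g' \<and> g 0 = 0 \<and> g' 0 = 1"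
  then have super: "ode_supersolution K g g'" and init: "g 0 = 0" "g' 0 = 1" by auto
  have K': "AE t in lebesgue. c \<le> t \<longrightarrow> K t \<le> critical_potential (1 + t)" if "0 < c" for c
    using K by eventually_elim (use that in auto)
  show "(\<forall>t>0. g t > 0) \<and> (\<exists>C>0. \<forall>t>3. g t \<ge> C * (sqrt (t * ln t) * ln (ln t)))"
  proof (intro conjI allI impI)
    fix t :: real assume "0 < t"
    \<comment> \<open>The starting point depends on \<open>t\<close>: as it can be taken arbitrarily
      close to \<open>0\<close>, every positive time lies beyond one.\<close>
    then obtain c where c: "0 < c" "c < t" "0 < g c"
      "0 < g' c * critical_solution (1 + c) - g c * critical_solution_deriv (1 + c)"
      using supersolution_initially_pos[OF super init] by metis
    show "0 < g t"
      using super c(1) _ K'[OF c(1)] by (rule critical_comparison(1)[where a = 1]) (use c in auto)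
  next
    \<comment> \<open>The bound \<open>c < 1\<close> gives \<open>ln (1 + c) < 1\<close>, so
      \<open>ln (ln (1 + c))\<close> is negative and \<open>?F c\<close> below is nonnegative; no
      additive constant spoils the final estimate.\<close>
    obtain c where c: "0 < c" "c < 1" "0 < g c"
      and Wc: "0 < g' c * critical_solution (1 + c) - g c * critical_solution_deriv (1 + c)"
      using supersolution_initially_pos[OF super init zero_less_one] by metis
    define W where "W t = g' t * critical_solution (1 + t) - g t * critical_solution_deriv (1 + t)" for t
    have W_mono: "W c \<le> W t" if "c \<le> t" for t
      unfolding W_def using super c(1) _ K'[OF c(1)]
      by (rule critical_comparison(2)[where a = 1]) (use c Wc that in auto)
    have C1: "C1_lip_deriv g g'" using super by (simp add: ode_supersolution_def)
    \<comment> \<open>Both terms have derivatives over the same denominator, the square of the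
      critical solution, so the derivative of \<open>?F\<close> has the sign of
      \<open>W x - W c\<close>.\<close>
    let ?F = "\<lambda>t. g t / critical_solution (1 + t) - W c * ln (ln (1 + t))"
    have F_mono: "?F c \<le> ?F t" if "c \<le> t" for t
    proof (rule DERIV_nonneg_imp_nondecreasing[OF that])
      fix x assume "c \<le> x" "x \<le> t"
      then have x: "0 < x" using c(1) by simp
      let ?r = "critical_solution (1 + x)"
      have r: "0 < ?r" "?r * ?r = (1 + x) * ln (1 + x)"
        using critical_solution_pos[of "1 + x"] critical_solution_square[of "1 + x"] x
        by (auto simp: power2_eq_square)
      have "((\<lambda>x. critical_solution (1 + x)) has_real_derivative critical_solution_deriv (1 + x)) (at x)"
        using critical_solution_has_deriv[of "1 + x"] x
          DERIV_shift[of critical_solution "critical_solution_deriv (1 + x)" x 1]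
        by (simp add: add.commute)
      then have "((\<lambda>t. g t / critical_solution (1 + t)) has_real_derivative W x / (?r * ?r)) (at x)"
        using r(1) by (auto intro!: derivative_eq_intros C1_lip_deriv_has_deriv[OF C1] x simp: W_def)
      moreover have "((\<lambda>t. W c * ln (ln (1 + t))) has_real_derivative W c / (?r * ?r)) (at x)"
        unfolding r(2) using x by (auto intro!: derivative_eq_intros simp: field_simps)
      ultimately have "(?F has_real_derivative W x / (?r * ?r) - W c / (?r * ?r)) (at x)"
        by (rule DERIV_diff)
      moreover have "W c / (?r * ?r) \<le> W x / (?r * ?r)"
        using W_mono[OF \<open>c \<le> x\<close>] by (intro divide_right_mono) auto
      ultimately show "\<exists>y. (?F has_real_derivative y) (at x) \<and> 0 \<le> y"
        by (intro exI conjI) auto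
    qed
    have "ln (1 + c) < 1" using ln_add_one_self_le_self[of c] c by simp
    then have "ln (ln (1 + c)) < 0" using c(1) by (simp add: ln_less_zero)
    then have "W c * ln (ln (1 + c)) \<le> 0" using Wc by (simp add: W_def mult_le_0_iff)
    moreover have "0 < g c / critical_solution (1 + c)"
      using c critical_solution_pos[of "1 + c"] by simp
    ultimately have Fc: "0 \<le> ?F c" by simp
    have "W c * (sqrt (t * ln t) * ln (ln t)) \<le> g t" if t: "3 < t" for t
    proof -
      \<comment> \<open>As \<open>exp 1 \<le> 3 < t\<close>, the iterated logarithm is nonnegative,
        which the monotonicity of products below requires.\<close>
      have "1 < ln t"
        using exp_le t exp_less_cancel_iff[of 1 "ln t"] by simp
      moreover have "ln t \<le> ln (1 + t)" using t by simp
      ultimately have le: "0 \<le> ln (ln t)" "ln (ln t) \<le> ln (ln (1 + t))" by simp_all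
      have r: "0 < critical_solution (1 + t)" using t critical_solution_pos[of "1 + t"] by simp
      have "sqrt (t * ln t) * ln (ln t) \<le> critical_solution (1 + t) * ln (ln (1 + t))"
        unfolding critical_solution_def using le t \<open>1 < ln t\<close>
        by (intro mult_mono real_sqrt_le_mono) auto
      then have "W c * (sqrt (t * ln t) * ln (ln t)) \<le> W c * (critical_solution (1 + t) * ln (ln (1 + t)))"
        using Wc by (intro mult_left_mono) (auto simp: W_def)
      also have "\<dots> \<le> g t"
      proof -
        have "W c * ln (ln (1 + t)) \<le> g t / critical_solution (1 + t)"
          using F_mono[of t] Fc c t by simp
        then show ?thesis using r by (simp add: pos_le_divide_eq mult_ac)
      qed
      finally show ?thesis .
    qed
    then show "\<exists>C>0. \<forall>t>3. g t \<ge> C * (sqrt (t * ln t) * ln (ln t))"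
      using Wc by (intro exI[of _ "W c"]) (simp add: W_def)
  qed
next
  fix t\<^sub>0 :: real and g g'
  assume "0 < t\<^sub>0" and "AE t in lebesgue_on {t\<^sub>0..}. K t \<le> 1 / (4 * t\<^sup>2) * (1 + 1 / (ln t)\<^sup>2)"
  then have K: "AE t in lebesgue. t \<in> {t\<^sub>0..} \<longrightarrow> K t \<le> critical_potential t"
    unfolding critical_potential_def by (subst (asm) AE_lebesgue_on_iff) auto
  assume "ode_solution K g g' \<and> (\<exists>t\<ge>0. g t \<noteq> 0)"
  then have sol: "ode_solution K g g'" and nz: "\<exists>t\<ge>0. g t \<noteq> 0" by auto
  \<comment> \<open>The given \<open>t\<^sub>0\<close> may be at most \<open>1\<close>, where the
    critical solution is not positive; any bound above \<open>1\<close> would do in place of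
    \<open>2\<close>.\<close>
  define T where "T = max t\<^sub>0 2"
  have K_T: "AE t in lebesgue. T \<le> t \<longrightarrow> K t \<le> critical_potential t"
    using K by eventually_elim (auto simp: T_def)
  have "1 < T" by (simp add: T_def)
  have no_later_zero: "g b \<noteq> 0" if "T \<le> a" "g a = 0" "a < b" for a b
  proof -
    have "g' a \<noteq> 0"
      using ode_solution_zero_data_imp_zero[OF assms sol, of a] nz that \<open>1 < T\<close> by auto
    then consider "0 < g' a" | "0 < - g' a" by linarith
    then show ?thesis
    proof cases
      case 1
      then show ?thesis
        using supersolution_pos_after_zero[OF ode_solution_imp_supersolution[OF sol] K_T \<open>1 < T\<close>] that
        by fastforce
    next
      case 2
      then show ?thesis
        using supersolution_pos_after_zero[OF ode_solution_imp_supersolution[OF ode_solution_uminus[OF sol]]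
            K_T \<open>1 < T\<close>] that
        by fastforce
    qed
  qed
  have "finite {t \<in> {T..}. g t = 0}"
  proof (cases "\<exists>a\<ge>T. g a = 0")
    case True
    then obtain a where a: "T \<le> a" "g a = 0" by blast
    then have "{t \<in> {T..}. g t = 0} \<subseteq> {a}"
      using no_later_zero by (auto intro: linorder_neqE)
    then show ?thesis by (rule finite_subset) simp
  next
    case False
    then have "{t \<in> {T..}. g t = 0} = {}" by auto
    then show ?thesis by (simp only: finite.emptyI)
  qed
  \<comment> \<open>Before \<open>T\<close> there is no comparison; finiteness comes from
    compactness and uniqueness.\<close>
  moreover have "finite {t \<in> {0..T}. g t = 0}"
    by (rule ode_solution_finite_zeros_Icc[OF assms sol nz])
  moreover have "{t \<in> {0..}. g t = 0} \<subseteq> {t \<in> {0..T}. g t = 0} \<union> {t \<in> {T..}. g t = 0}" by auto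
  ultimately show "nonoscillatory g"
    unfolding nonoscillatory_def by (meson finite_UnI finite_subset)
qed

end
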